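(* For every $\delta\in(0,1/2)$ there is a constant $C_\delta$ such that the following holds. Let $w_1\ge\dots\ge w_n\ge0$ with $\sum_iw_i=1$, let $\theta>0$, let $f(x)=\mathrm{sign}\left(\sum_iw_ix_i-\theta\right)$ on $\{0,1\}^n=\mathbb F_2^n$, and suppose its margin $m=\min_{x\in\{0,1\}^n}|\sum_iw_ix_i-\theta|$ is positive. Then $$R^{lin}_\delta(f)\le C_\delta\cdot\frac{\theta}{m}\log_2\!\left(\frac{2\theta}{m}\right).$$
   Context: $\mathrm{sign}(z)=1$ if $z\ge0$ and $0$ otherwise (note $\theta\ge m$ since $x=0$ gives $|0-\theta|=\theta$). $R^{lin}_\delta(f)$ is the smallest $k$ such that there exist a probability distribution over $k$-tuples $(s_1,\dots,s_k)$ of vectors in $\mathbb F_2^n$ and a function $g\colon\mathbb F_2^k\to\mathbb F_2$ with $\Pr[g(s_1\cdot x,\dots,s_k\cdot x)=f(x)]\ge1-\delta$ for every $x\in\mathbb F_2^n$. The bound is a rendering of the paper's "a randomized linear sketch of size $O(\frac{\theta}{m}\log\frac{\theta}{m})$ that succeeds with any constant probability". *)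

theory Defs
  imports "HOL-Probability.Probability" "HOL-Library.Z2" "Jordan_Normal_Form.Matrix"
begin

unbundle no inner_syntax
unbundle no vec_syntax

text \<open>
  Vectors over \<open>\<F>\<^sub>2\<close> are \<^typ>\<open>bit vec\<close>, with \<open>\<F>\<^sub>2\<^sup>n\<close> being \<^term>\<open>carrier_vec n\<close>. Entries of vectors are
  indexed from 0, so the weights \<open>w\<^sub>1, \<dots>, w\<^sub>n\<close> are \<open>w $ 0, \<dots>, w $ (n - 1)\<close>.
\<close>

definition sign01 :: "real \<Rightarrow> bit" where
  "sign01 z = (if z \<ge> 0 then 1 else 0)"

definition weighted_sum :: "real vec \<Rightarrow> bit vec \<Rightarrow> real" where
  "weighted_sum w x = (\<Sum>i<dim_vec w. w $ i * of_bool (x $ i = 1))"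

definition ltf :: "real vec \<Rightarrow> real \<Rightarrow> bit vec \<Rightarrow> bit" where
  "ltf w \<theta> x = sign01 (weighted_sum w x - \<theta>)"

definition ltf_margin :: "real vec \<Rightarrow> real \<Rightarrow> real" where
  "ltf_margin w \<theta> = Min ((\<lambda>x. \<bar>weighted_sum w x - \<theta>\<bar>) ` carrier_vec (dim_vec w))"

definition has_lin_sketch :: "nat \<Rightarrow> real \<Rightarrow> (bit vec \<Rightarrow> bit) \<Rightarrow> nat \<Rightarrow> bool" where
  "has_lin_sketch n \<delta> f k \<longleftrightarrow>
     (\<exists>(D :: bit vec list pmf) (g :: bit vec \<Rightarrow> bit).
        set_pmf D \<subseteq> {ss. length ss = k \<and> set ss \<subseteq> carrier_vec n} \<and>
        (\<forall>x\<in>carrier_vec n.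
           measure_pmf.prob D {ss. g (vec k (\<lambda>j. (ss ! j) \<bullet> x)) = f x} \<ge> 1 - \<delta>))"

definition R_lin :: "nat \<Rightarrow> real \<Rightarrow> (bit vec \<Rightarrow> bit) \<Rightarrow> nat" where
  "R_lin n \<delta> f = (LEAST k. has_lin_sketch n \<delta> f k)"

text \<open>The minima in \<^const>\<open>ltf_margin\<close> and \<^const>\<open>R_lin\<close> are attained, by the following two facts.\<close>

lemma finite_carrier_vec_bit: "finite (carrier_vec n :: bit vec set)"
proof -
  have "finite (UNIV :: bit set)"
    by (rule finite_subset[of _ "{0, 1}"]) (auto intro: bit.exhaust)
  then have "finite {xs :: bit list. set xs \<subseteq> UNIV \<and> length xs = n}"
    by (rule finite_lists_length_eq)
  moreover have "carrier_vec n \<subseteq> vec_of_list ` {xs :: bit list. set xs \<subseteq> UNIV \<and> length xs = n}"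
  proof
    fix v :: "bit vec" assume "v \<in> carrier_vec n"
    then show "v \<in> vec_of_list ` {xs :: bit list. set xs \<subseteq> UNIV \<and> length xs = n}"
      by (intro image_eqI[of _ _ "list_of_vec v"]) (auto simp: vec_list)
  qed
  ultimately show ?thesis
    by (meson finite_imageI finite_subset)
qed

lemma has_lin_sketch_dim:
  assumes "\<delta> \<ge> 0"
  shows "has_lin_sketch n \<delta> f n"
proof -
  have "vec n (\<lambda>j. (unit_vecs n ! j) \<bullet> x) = x" if "x \<in> carrier_vec n" for x :: "bit vec"
    using that by (intro eq_vecI) (auto simp: unit_vecs_def)
  then show ?thesis
    unfolding has_lin_sketch_def using assms
    by (intro exI[of _ "return_pmf (unit_vecs n)"] exI[of _ f]) (auto simp: unit_vecs_def)
qed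

end

theory Submission
  imports Defs
begin

text \<open>
  Write \<open>m\<close> for the margin and \<open>\<rho> = \<theta> / m\<close>. Coordinates of weight below \<open>2 m\<close> never change the value
  of the function, so let \<open>T\<close> be the set of the other coordinates in the support of \<open>x\<close>. If
  \<open>f x = 0\<close> then \<open>|T| \<le> \<rho> / 2\<close>.

  The decoder \<open>g\<close> is not allowed to see the random choices, so the sketch combines two parts. The
  first one sends coordinate \<open>i\<close> to a random column of constant length that is zero with probability
  \<open>1 - \<delta> / \<rho>\<close> and uniform otherwise; the sum of these columns over \<open>T\<close> vanishes with probability at
  least \<open>1 - \<delta> / 2\<close> if \<open>|T| \<le> \<rho> / 2\<close> and with probability at most \<open>\<delta>\<close> if \<open>|T|\<close> exceeds \<open>M = K \<lceil>\<rho>\<rceil>\<close>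
  for a constant \<open>K\<close> depending on \<open>\<delta>\<close>. If it does not vanish, \<open>g\<close> answers 1.

  The second part recovers the multiset of rounded weights of \<open>T\<close> when \<open>|T| \<le> M\<close>. Weights are capped
  at \<open>\<theta>\<close> and rounded to multiples of \<open>m / (2 M)\<close>, which leaves \<open>O(M \<rho>)\<close> classes, and coordinates of
  one class are hashed into \<open>O(M\<^sup>2 / \<delta>)\<close> buckets, so that \<open>T\<close> is hashed without collisions with
  probability at least \<open>1 - \<delta> / 2\<close>. The class can be read off the pair of class and bucket, hence \<open>g\<close>
  does not need to know the hash function. The set of at most \<open>M\<close> occupied pairs, out of
  polynomially many in \<open>\<rho>\<close>, is transmitted by a fixed linear code of length \<open>O(M log \<rho>)\<close>.
\<close>

text \<open>These two default simplification rules turn the field operations of \<^typ>\<open>bit\<close> into bit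
  operations, to which the rules for sums no longer apply.\<close>

declare add_bit_eq_xor [simp del] mult_bit_eq_and [simp del]

section \<open>Small sets and the linear code that encodes them\<close>

lemma UNIV_bit: "(UNIV :: bit set) = {0, 1}"
  by (auto intro: bit.exhaust)

lemma finite_UNIV_bit [simp]: "finite (UNIV :: bit set)"
  by (simp add: UNIV_bit)

lemma card_UNIV_bit [simp]: "card (UNIV :: bit set) = 2"
  unfolding UNIV_bit by (subst card_2_iff) auto

text \<open>A set of at most \<open>M\<close> elements is listed and padded to length exactly
  \<open>M\<close> with the dummy entry \<open>N\<close>, which lies outside \<open>{..<N}\<close>
  and is removed again by intersecting. There are \<open>N + 1\<close> letters, hence the
  bound.\<close>

lemma card_subsets_card_le:
  "card {S. S \<subseteq> {..<N::nat} \<and> card S \<le> M} \<le> (N + 1) ^ M"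
proof -
  let ?L = "{l. set l \<subseteq> {..N} \<and> length l = M}"
  have "{S. S \<subseteq> {..<N} \<and> card S \<le> M} \<subseteq> (\<lambda>l. set l \<inter> {..<N}) ` ?L"
  proof (intro subsetI)
    fix S assume S: "S \<in> {S. S \<subseteq> {..<N} \<and> card S \<le> M}"
    then have "finite S"
      by (auto intro: finite_subset)
    then obtain l where l: "set l = S" "distinct l"
      using finite_distinct_list by blast
    let ?l = "l @ replicate (M - card S) N"
    have "length ?l = M" "set ?l \<inter> {..<N} = S" "set ?l \<subseteq> {..N}"
      using l S distinct_card[of l] by auto
    then show "S \<in> (\<lambda>l. set l \<inter> {..<N}) ` ?L"
      by (intro image_eqI[of _ _ ?l]) auto
  qed
  moreover have fin: "finite ?L"
    by (intro finite_lists_length_eq) auto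
  ultimately have "card {S. S \<subseteq> {..<N} \<and> card S \<le> M} \<le> card ?L"
    by (rule surj_card_le[rotated])
  also have "\<dots> = (N + 1) ^ M"
    using card_lists_length_eq[of "{..N}" M] by simp
  finally show ?thesis .
qed

lemma bit_add_eq_iff: "a + b = c \<longleftrightarrow> a = c + (b :: bit)"
  by (cases a; cases b; cases c) auto

text \<open>A greedy (Gilbert--Varshamov) choice: each new column avoids all sums of two earlier
  subset sums.\<close>

lemma exists_columns_inj_subset_sums:
  assumes "(N + 1) ^ (2 * M) < 2 ^ k"
  shows "\<exists>u :: nat \<Rightarrow> nat \<Rightarrow> bit. \<forall>S S'. S \<subseteq> {..<N} \<longrightarrow> S' \<subseteq> {..<N} \<longrightarrow> card S \<le> M \<longrightarrow> card S' \<le> M \<longrightarrow>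
           (\<forall>j<k. (\<Sum>i\<in>S. u i j) = (\<Sum>i\<in>S'. u i j)) \<longrightarrow> S = S'"
  using assms
proof (induction N)
  case 0
  then show ?case by auto
next
  case (Suc N)
  have "(N + 1) ^ (2 * M) \<le> (Suc N + 1) ^ (2 * M)"
    by (intro power_mono) auto
  with Suc.prems have less: "(N + 1) ^ (2 * M) < 2 ^ k"
    by linarith
  obtain u :: "nat \<Rightarrow> nat \<Rightarrow> bit" where u: "\<And>S S'. S \<subseteq> {..<N} \<Longrightarrow> S' \<subseteq> {..<N} \<Longrightarrow>
      card S \<le> M \<Longrightarrow> card S' \<le> M \<Longrightarrow> \<forall>j<k. (\<Sum>i\<in>S. u i j) = (\<Sum>i\<in>S'. u i j) \<Longrightarrow> S = S'"
    using Suc.IH[OF less] by metis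
  define F where "F = {S. S \<subseteq> {..<N} \<and> card S \<le> M}"
  have "finite F"
    by (rule finite_subset[of _ "Pow {..<N}"]) (auto simp: F_def)
  \<comment> \<open>\<open>X\<close> holds the forbidden values of column \<open>N\<close>. It has
    at most as many elements as there are pairs of small sets, which is where the exponent
    \<open>2 * M\<close> comes from; fewer than \<open>2 ^ k\<close> values are forbidden, so one is
    free.\<close>
  define X where "X = (\<lambda>(S, S'). restrict (\<lambda>j. (\<Sum>i\<in>S. u i j) + (\<Sum>i\<in>S'. u i j)) {..<k}) ` (F \<times> F)"
  have "card X \<le> card (F \<times> F)"
    unfolding X_def using \<open>finite F\<close> by (intro card_image_le) auto
  also have "\<dots> \<le> (N + 1) ^ M * (N + 1) ^ M"
    unfolding card_cartesian_product F_def by (intro mult_mono card_subsets_card_le) auto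
  also have "\<dots> < 2 ^ k"
    using less by (simp add: mult_2 power_add)
  also have "2 ^ k = card ({..<k} \<rightarrow>\<^sub>E (UNIV :: bit set))"
    by (simp add: card_PiE)
  finally have "\<not> ({..<k} \<rightarrow>\<^sub>E (UNIV :: bit set)) \<subseteq> X"
    using card_mono[of X "{..<k} \<rightarrow>\<^sub>E UNIV"] \<open>finite F\<close> by (auto simp: X_def)
  then obtain a where a: "a \<in> {..<k} \<rightarrow>\<^sub>E (UNIV :: bit set)" "a \<notin> X"
    by blast
  have new: "\<not> (\<forall>j<k. a j + (\<Sum>i\<in>S. u i j) = (\<Sum>i\<in>S'. u i j))" if "S \<in> F" "S' \<in> F" for S S'
  proof
    assume "\<forall>j<k. a j + (\<Sum>i\<in>S. u i j) = (\<Sum>i\<in>S'. u i j)"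
    then have "a = restrict (\<lambda>j. (\<Sum>i\<in>S'. u i j) + (\<Sum>i\<in>S. u i j)) {..<k}"
      using a(1) by (intro ext) (auto simp: bit_add_eq_iff PiE_def extensional_def)
    then have "a \<in> X"
      unfolding X_def using that by (intro image_eqI[of _ _ "(S', S)"]) auto
    with a(2) show False by contradiction
  qed
  let ?u = "u(N := a)"
  have sum_out: "(\<Sum>i\<in>S. ?u i j) = (\<Sum>i\<in>S. u i j)" if "N \<notin> S" for S j
    using that by (intro sum.cong) auto
  have sum_in: "(\<Sum>i\<in>S. ?u i j) = a j + (\<Sum>i\<in>S - {N}. u i j)" if "N \<in> S" "S \<subseteq> {..<Suc N}" for S j
  proof -
    have "finite S"
      using that(2) finite_subset by blast
    then show ?thesis
      using that by (simp add: sum.remove[of S N] sum_out del: fun_upd_apply) simp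
  qed
  show ?case
  proof (intro exI[of _ ?u] allI impI)
    fix S S' :: "nat set"
    assume S: "S \<subseteq> {..<Suc N}" "S' \<subseteq> {..<Suc N}" "card S \<le> M" "card S' \<le> M"
      and eq: "\<forall>j<k. (\<Sum>i\<in>S. ?u i j) = (\<Sum>i\<in>S'. ?u i j)"
    have sub: "R - {N} \<in> F" if "R \<subseteq> {..<Suc N}" "card R \<le> M" for R
      using that card_Diff1_le[of R N] by (auto simp: F_def less_Suc_eq)
    have inj: "S - {N} = S' - {N}" if "\<forall>j<k. (\<Sum>i\<in>S - {N}. u i j) = (\<Sum>i\<in>S' - {N}. u i j)"
      using u[of "S - {N}" "S' - {N}"] sub[OF S(1,3)] sub[OF S(2,4)] that by (auto simp: F_def)
    show "S = S'"
    \<comment> \<open>If \<open>N\<close> lies in both sets, \<open>a\<close> cancels and the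
      earlier columns decide; if it lies in exactly one, equal sums would make \<open>a\<close> a
      forbidden value.\<close>
    proof (cases "N \<in> S"; cases "N \<in> S'")
      assume N: "N \<in> S" "N \<in> S'"
      with eq sum_in S have "S - {N} = S' - {N}"
        by (intro inj) (simp del: fun_upd_apply)
      with N show ?thesis by blast
    next
      assume N: "N \<in> S" "N \<notin> S'"
      then show ?thesis
        using new[OF sub[OF S(1,3)] sub[OF S(2,4)]] eq sum_in[of S] sum_out[of S'] S
        by (simp del: fun_upd_apply) blast
    next
      assume N: "N \<notin> S" "N \<in> S'"
      then show ?thesis
        using new[OF sub[OF S(2,4)] sub[OF S(1,3)]] eq sum_in[of S'] sum_out[of S] S
        by (simp del: fun_upd_apply) metis
    next
      assume N: "N \<notin> S" "N \<notin> S'"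
      then show ?thesis
        using inj eq sum_out[of S] sum_out[of S'] by (simp del: fun_upd_apply)
    qed
  qed
qed

section \<open>Product distributions and collisions of a random hash function\<close>

lemma prob_bind_pmf:
  "measure_pmf.prob (bind_pmf M N) X = measure_pmf.expectation M (\<lambda>x. measure_pmf.prob (N x) X)"
proof -
  have "ennreal (measure_pmf.prob (bind_pmf M N) X) = (\<integral>\<^sup>+x. ennreal (measure_pmf.prob (N x) X) \<partial>M)"
    by (simp flip: measure_pmf.emeasure_eq_measure)
  also have "\<dots> = ennreal (measure_pmf.expectation M (\<lambda>x. measure_pmf.prob (N x) X))"
    by (intro nn_integral_eq_integral measure_pmf.integrable_const_bound[where B = 1]) auto
  finally show ?thesis
    by (subst (asm) ennreal_inj) (auto intro: integral_nonneg)
qed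

text \<open>Independence lets the value at \<open>x\<close> be drawn last, with all other values
  fixed. This is the induction step of both probability estimates below.\<close>

lemma prob_Pi_pmf_insert:
  assumes "finite A" "x \<notin> A"
  shows "measure_pmf.prob (Pi_pmf (insert x A) d p) E =
           measure_pmf.expectation (Pi_pmf A d p) (\<lambda>f. measure_pmf.prob (p x) {y. f(x := y) \<in> E})"
proof -
  have "Pi_pmf (insert x A) d p = bind_pmf (Pi_pmf A d p) (\<lambda>f. map_pmf (\<lambda>y. f(x := y)) (p x))"
    unfolding Pi_pmf_insert'[OF assms] map_pmf_def by (rule bind_commute_pmf)
  then show ?thesis
    by (simp add: prob_bind_pmf vimage_def)
qed

text \<open>The sketch draws a value for every coordinate, but its errors depend only on the draws
  at the heavy support \<open>T\<close>; this removes the other draws.\<close>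

lemma prob_Pi_pmf_subset:
  assumes "finite A" "T \<subseteq> A" and "\<And>f. (\<lambda>i. if i \<in> T then f i else d) \<in> E \<longleftrightarrow> f \<in> E"
  shows "measure_pmf.prob (Pi_pmf A d p) E = measure_pmf.prob (Pi_pmf T d p) E"
  unfolding Pi_pmf_subset[OF assms(1,2)] using assms(3) by (simp add: vimage_def)

lemma prob_not_inj_on:
  assumes "finite T" "b > 0"
  shows "measure_pmf.prob (Pi_pmf T d (\<lambda>_. pmf_of_set {..<b::nat})) {r. \<not> inj_on r T} \<le> (real (card T))\<^sup>2 / real b"
  using assms(1)
proof (induction T)
  case empty
  then show ?case by simp
next
  case (insert i T)
  let ?P = "\<lambda>T. Pi_pmf T d (\<lambda>_. pmf_of_set {..<b})"
  have ne: "{..<b} \<noteq> {}"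
    using assms(2) by auto
  have "measure_pmf.prob (?P (insert i T)) {r. \<not> inj_on r (insert i T)} =
    measure_pmf.expectation (?P T) (\<lambda>r. measure_pmf.prob (pmf_of_set {..<b}) {y. r(i := y) \<in> {r. \<not> inj_on r (insert i T)}})"
    by (rule prob_Pi_pmf_insert[OF insert.hyps])
  also have "\<dots> \<le> measure_pmf.expectation (?P T) (\<lambda>r. indicator {r. \<not> inj_on r T} r + real (card T) / real b)"
  proof (intro integral_mono measure_pmf.integrable_const_bound[where B = "1 + real (card T) / real b"])
    fix r
    show "measure_pmf.prob (pmf_of_set {..<b}) {y. r(i := y) \<in> {r. \<not> inj_on r (insert i T)}}
       \<le> indicator {r. \<not> inj_on r T} r + real (card T) / real b"
    proof (cases "inj_on r T")
      case True
      have "T - {i} = T"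
        using insert.hyps by auto
      then have "{y. r(i := y) \<in> {r. \<not> inj_on r (insert i T)}} \<subseteq> r ` T"
        using True by (auto intro: inj_on_fun_updI)
      then have "measure_pmf.prob (pmf_of_set {..<b}) {y. r(i := y) \<in> {r. \<not> inj_on r (insert i T)}}
          \<le> measure_pmf.prob (pmf_of_set {..<b}) (r ` T)"
        by (intro measure_pmf.finite_measure_mono) auto
      also have "\<dots> = real (card ({..<b} \<inter> r ` T)) / real b"
        using measure_pmf_of_set[OF ne] by simp
      also have "\<dots> \<le> real (card T) / real b"
        using insert.hyps card_image_le[of T r] card_mono[of "r ` T" "{..<b} \<inter> r ` T"]
        by (intro divide_right_mono) auto
      finally show ?thesis using True by simp
    next
      case False
      then show ?thesis
        by (simp add: add_increasing2)
    qed
  qed (auto simp: indicator_def add_increasing2)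
  also have "\<dots> = measure_pmf.prob (?P T) {r. \<not> inj_on r T} + real (card T) / real b"
    by (subst Bochner_Integration.integral_add)
       (auto intro!: measure_pmf.integrable_const_bound[where B = 1])
  also have "\<dots> \<le> (real (card T))\<^sup>2 / real b + real (card T) / real b"
    using insert.IH by simp
  also have "\<dots> \<le> (real (card (insert i T)))\<^sup>2 / real b"
    using insert.hyps assms(2) by (simp add: power2_eq_square divide_simps algebra_simps)
  finally show ?case .
qed

section \<open>Sums of sparse random columns\<close>

definition sparse_column :: "real \<Rightarrow> nat \<Rightarrow> (nat \<Rightarrow> bit) pmf" where
  "sparse_column p q = bind_pmf (bernoulli_pmf p)
     (\<lambda>c. if c then pmf_of_set (PiE_dflt {..<q} 0 (\<lambda>_. UNIV)) else return_pmf (\<lambda>_. 0))"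

lemma set_sparse_column: "set_pmf (sparse_column p q) \<subseteq> PiE_dflt {..<q} 0 (\<lambda>_. UNIV)"
proof -
  let ?V = "PiE_dflt {..<q} 0 (\<lambda>_. UNIV) :: (nat \<Rightarrow> bit) set"
  have "set_pmf (pmf_of_set ?V) = ?V"
    by (intro set_pmf_of_set) auto
  moreover have "(\<lambda>_. 0) \<in> ?V"
    by (simp add: PiE_dflt_def)
  ultimately show ?thesis
    unfolding sparse_column_def set_bind_pmf by (intro UN_least) auto
qed

lemma pmf_sparse_column:
  assumes "0 \<le> p" "p \<le> 1" "s \<in> PiE_dflt {..<q} 0 (\<lambda>_. UNIV)"
  shows "pmf (sparse_column p q) s = (1 - p) * of_bool (s = (\<lambda>_. 0)) + p / 2 ^ q"
proof -
  let ?V = "PiE_dflt {..<q} 0 (\<lambda>_. UNIV) :: (nat \<Rightarrow> bit) set"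
  have "finite ?V" "card ?V = 2 ^ q" "?V \<noteq> {}"
    by (auto simp: card_PiE_dflt)
  then have "pmf (pmf_of_set ?V) s = 1 / 2 ^ q"
    using assms(3) by simp
  then show ?thesis
    unfolding sparse_column_def pmf_bind using assms(1,2)
    by (simp add: indicator_def)
qed

text \<open>Given the sum \<open>s\<close> of the earlier columns, the new column must equal
  \<open>s\<close>, since bits are their own negatives. It does so with probability
  \<open>p / 2 ^ q\<close>, plus \<open>1 - p\<close> if \<open>s\<close> is zero. The resulting
  recurrence \<open>a' = (1 - p) * a + p / 2 ^ q\<close> has fixed point \<open>1 / 2 ^ q\<close>
  and starts at 1.\<close>

lemma prob_sum_sparse_columns_eq_0:
  assumes "finite T" "0 \<le> p" "p \<le> 1"
  shows "measure_pmf.prob (Pi_pmf T (\<lambda>_. 0) (\<lambda>_. sparse_column p q)) {c. \<forall>j<q. (\<Sum>i\<in>T. c i j) = 0}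
           = 1 / 2 ^ q + (1 - p) ^ card T * (1 - 1 / 2 ^ q)"
  using assms(1)
proof (induction T)
  case empty
  then show ?case by simp
next
  case (insert i T)
  let ?P = "\<lambda>T. Pi_pmf T (\<lambda>_. 0) (\<lambda>_. sparse_column p q)"
  let ?E = "\<lambda>T. {c. \<forall>j<q. (\<Sum>i\<in>T. c i j) = (0::bit)}"
  have "measure_pmf.prob (?P (insert i T)) (?E (insert i T)) = measure_pmf.expectation (?P T) (\<lambda>c.
      measure_pmf.prob (sparse_column p q) {y. c(i := y) \<in> ?E (insert i T)})"
    by (rule prob_Pi_pmf_insert[OF insert.hyps])
  also have "\<dots> = measure_pmf.expectation (?P T) (\<lambda>c. (1 - p) * indicator (?E T) c + p / 2 ^ q)"
  proof (intro integral_cong_AE AE_pmfI)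
    fix c
    assume "c \<in> set_pmf (?P T)"
    define s where "s = (\<lambda>j. if j < q then \<Sum>i\<in>T. c i j else 0)"
    have s: "s \<in> PiE_dflt {..<q} 0 (\<lambda>_. UNIV)"
      by (auto simp: s_def PiE_dflt_def)
    have upd: "(\<Sum>k\<in>T. (c(i := y)) k j) = (\<Sum>k\<in>T. c k j)" for y j
      using insert.hyps by (intro sum.cong) auto
    have iff: "c(i := y) \<in> ?E (insert i T) \<longleftrightarrow> (\<forall>j<q. y j = s j)" for y
      using insert.hyps by (simp add: upd s_def bit_add_eq_iff del: fun_upd_apply) simp
    have "measure_pmf.prob (sparse_column p q) {y. c(i := y) \<in> ?E (insert i T)} =
        measure_pmf.prob (sparse_column p q) {s}"
    \<comment> \<open>The left event constrains only the first \<open>q\<close> entries, while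
      equality with \<open>s\<close> also demands zeros beyond them. On the support of
      \<open>sparse_column\<close> these zeros are guaranteed.\<close>
    proof (rule measure_eq_AE)
      show "AE y in sparse_column p q. y \<in> {y. c(i := y) \<in> ?E (insert i T)} \<longleftrightarrow> y \<in> {s}"
      proof (intro AE_pmfI)
        fix y assume "y \<in> set_pmf (sparse_column p q)"
        then have "y \<in> PiE_dflt {..<q} 0 (\<lambda>_. UNIV)"
          using set_sparse_column by blast
        then show "y \<in> {y. c(i := y) \<in> ?E (insert i T)} \<longleftrightarrow> y \<in> {s}"
          unfolding mem_Collect_eq[of y "\<lambda>y. c(i := y) \<in> ?E (insert i T)"] iff
          using s by (auto simp: PiE_dflt_def fun_eq_iff not_less) (metis not_less)
      qed
    qed auto
    also have "\<dots> = (1 - p) * indicator (?E T) c + p / 2 ^ q"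
      using pmf_sparse_column[OF assms(2,3) s]
      by (auto simp: measure_pmf_single s_def indicator_def fun_eq_iff)
    finally show "measure_pmf.prob (sparse_column p q) {y. c(i := y) \<in> ?E (insert i T)} =
      (1 - p) * indicator (?E T) c + p / 2 ^ q" .
  qed auto
  also have "\<dots> = (1 - p) * measure_pmf.prob (?P T) (?E T) + p / 2 ^ q"
    by (subst Bochner_Integration.integral_add)
       (auto intro!: measure_pmf.integrable_const_bound[where B = 1])
  also have "\<dots> = 1 / 2 ^ q + (1 - p) ^ card (insert i T) * (1 - 1 / 2 ^ q)"
    unfolding insert.IH using insert.hyps by (simp add: field_simps)
  finally show ?case .
qed

section \<open>Sketches given by random columns\<close>

text \<open>The sketching vectors are the rows of a random matrix; applying the matrix to
  \<open>x\<close> adds up the columns indexed by the support of \<open>x\<close>. Describing a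
  sketch by columns allows each coordinate to be treated separately.\<close>

lemma has_lin_sketchI:
  fixes P :: "'a pmf" and col :: "'a \<Rightarrow> nat \<Rightarrow> nat \<Rightarrow> bit"
  assumes "\<And>x. x \<in> carrier_vec n \<Longrightarrow>
    measure_pmf.prob P {\<omega>. g (vec k (\<lambda>j. \<Sum>i | i < n \<and> x $ i = 1. col \<omega> i j)) = f x} \<ge> 1 - \<delta>"
  shows "has_lin_sketch n \<delta> f k"
proof -
  define rows where "rows = (\<lambda>\<omega>. map (\<lambda>j. vec n (\<lambda>i. col \<omega> i j)) [0..<k])"
  have "vec k (\<lambda>j. rows \<omega> ! j \<bullet> x) = vec k (\<lambda>j. \<Sum>i | i < n \<and> x $ i = 1. col \<omega> i j)"
    if x: "x \<in> carrier_vec n" for x \<omega>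
  proof (rule eq_vecI)
    fix j assume "j < dim_vec (vec k (\<lambda>j. \<Sum>i | i < n \<and> x $ i = 1. col \<omega> i j))"
    then have j: "j < k" by simp
    have "rows \<omega> ! j \<bullet> x = (\<Sum>i<n. col \<omega> i j * x $ i)"
      using j x by (auto simp: rows_def scalar_prod_def lessThan_atLeast0 intro: sum.cong)
    also have "\<dots> = (\<Sum>i | i < n \<and> x $ i = 1. col \<omega> i j)"
      by (intro sum.mono_neutral_cong_right) auto
    finally show "vec k (\<lambda>j. rows \<omega> ! j \<bullet> x) $ j = vec k (\<lambda>j. \<Sum>i | i < n \<and> x $ i = 1. col \<omega> i j) $ j"
      using j by simp
  qed simp
  then have "measure_pmf.prob (map_pmf rows P) {ss. g (vec k (\<lambda>j. ss ! j \<bullet> x)) = f x} \<ge> 1 - \<delta>"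
    if "x \<in> carrier_vec n" for x
    using assms[OF that] that by (simp add: vimage_def)
  moreover have "set_pmf (map_pmf rows P) \<subseteq> {ss. length ss = k \<and> set ss \<subseteq> carrier_vec n}"
    by (auto simp: rows_def)
  ultimately show ?thesis
    unfolding has_lin_sketch_def by blast
qed

section \<open>Consequences of the margin: light coordinates and rounding\<close>

lemma weighted_sum_eq:
  assumes "w \<in> carrier_vec n"
  shows "weighted_sum w x = (\<Sum>i | i < n \<and> x $ i = 1. w $ i)"
  unfolding weighted_sum_def using assms
  by (intro sum.mono_neutral_cong_right) auto

text \<open>Every index set is the support of some input, so the margin controls all subset sums of
  the weights.\<close>

lemma ltf_margin_le:
  assumes "w \<in> carrier_vec n" "U \<subseteq> {..<n}"
  shows "ltf_margin w \<theta> \<le> \<bar>(\<Sum>i\<in>U. w $ i) - \<theta>\<bar>"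
proof -
  define x where "x = vec n (\<lambda>i. of_bool (i \<in> U) :: bit)"
  have "{i. i < n \<and> x $ i = 1} = U"
    using assms(2) by (auto simp: x_def split: if_splits)
  then have "weighted_sum w x = (\<Sum>i\<in>U. w $ i)"
    using weighted_sum_eq[OF assms(1)] by simp
  moreover have "ltf_margin w \<theta> \<le> \<bar>weighted_sum w x - \<theta>\<bar>"
    unfolding ltf_margin_def using assms(1) finite_carrier_vec_bit
    by (intro Min_le) (auto simp: x_def)
  ultimately show ?thesis by simp
qed

text \<open>Adding a coordinate of weight below twice the margin cannot jump over the forbidden
  interval around the threshold, so such coordinates are irrelevant.\<close>

lemma light_coordinates_irrelevant:
  assumes w: "w \<in> carrier_vec n" and "0 < ltf_margin w \<theta>"
    and "finite S" "S \<subseteq> {i. i < n \<and> w $ i < 2 * ltf_margin w \<theta>}" "U \<subseteq> {..<n}"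
    and "(\<Sum>i\<in>U. w $ i) < \<theta>"
  shows "(\<Sum>i\<in>U \<union> S. w $ i) < \<theta>"
  using assms(3,4)
proof (induction S)
  case empty
  then show ?case using assms by simp
next
  case (insert i S)
  have fin: "finite (U \<union> S)"
    using assms(5) insert.hyps finite_subset by blast
  have sub: "U \<union> S \<subseteq> {..<n}" "U \<union> insert i S \<subseteq> {..<n}"
    using assms(5) insert.prems by auto
  have IH: "(\<Sum>i\<in>U \<union> S. w $ i) < \<theta>"
    using insert by auto
  show ?case
  proof (cases "i \<in> U")
    case True
    then have "U \<union> insert i S = U \<union> S" by auto
    then show ?thesis using IH by simp
  next
    case False
    then have "(\<Sum>i\<in>U \<union> insert i S. w $ i) = w $ i + (\<Sum>i\<in>U \<union> S. w $ i)"
      using fin insert.hyps by simp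
    moreover have "w $ i < 2 * ltf_margin w \<theta>"
      using insert.prems by auto
    ultimately show ?thesis
      using IH ltf_margin_le[OF w sub(1), of \<theta>] ltf_margin_le[OF w sub(2), of \<theta>] by linarith
  qed
qed

lemma ltf_eq_heavy:
  assumes w: "w \<in> carrier_vec n" and nonneg: "\<forall>i<n. 0 \<le> w $ i" and m: "0 < ltf_margin w \<theta>"
  shows "ltf w \<theta> x = of_bool (\<theta> \<le> (\<Sum>i | i < n \<and> 2 * ltf_margin w \<theta> \<le> w $ i \<and> x $ i = 1. w $ i))"
proof -
  let ?T = "{i. i < n \<and> 2 * ltf_margin w \<theta> \<le> w $ i \<and> x $ i = 1}"
  let ?S = "{i. i < n \<and> w $ i < 2 * ltf_margin w \<theta> \<and> x $ i = 1}"
  have un: "{i. i < n \<and> x $ i = 1} = ?T \<union> ?S"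
    by auto
  have "(\<Sum>i\<in>?T \<union> ?S. w $ i) < \<theta>" if "(\<Sum>i\<in>?T. w $ i) < \<theta>"
    using w m by (rule light_coordinates_irrelevant) (use that in auto)
  moreover have "(\<Sum>i\<in>?T. w $ i) \<le> (\<Sum>i\<in>?T \<union> ?S. w $ i)"
    using nonneg by (intro sum_mono2) auto
  ultimately have "\<theta> \<le> (\<Sum>i\<in>?T \<union> ?S. w $ i) \<longleftrightarrow> \<theta> \<le> (\<Sum>i\<in>?T. w $ i)"
    by linarith
  then show ?thesis
    unfolding ltf_def sign01_def weighted_sum_eq[OF w] un by simp
qed

text \<open>Rounding down loses at most \<epsilon> per element, in total at most
  \<open>m / 2\<close>. Capping at \<theta> is harmless, because one capped weight already reaches
  \<theta>. So a sum of at least \<theta> stays above \<open>\<theta> - m\<close>, while a sum below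
  \<theta> is at most \<open>\<theta> - m\<close> by the margin and does not grow.\<close>

lemma rounded_threshold:
  fixes v :: "'a \<Rightarrow> real" and M :: nat
  assumes "finite T" "card T \<le> M" "M > 0" "0 < m" "0 < \<theta>" "\<And>i. i \<in> T \<Longrightarrow> 0 \<le> v i"
    and margin: "m \<le> \<bar>(\<Sum>i\<in>T. v i) - \<theta>\<bar>"
  defines "\<epsilon> \<equiv> m / (2 * real M)"
  shows "\<theta> - m < \<epsilon> * real (\<Sum>i\<in>T. nat \<lfloor>min (v i) \<theta> / \<epsilon>\<rfloor>) \<longleftrightarrow> \<theta> \<le> (\<Sum>i\<in>T. v i)"
proof -
  define Q where "Q = \<epsilon> * real (\<Sum>i\<in>T. nat \<lfloor>min (v i) \<theta> / \<epsilon>\<rfloor>)"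
  have \<epsilon>: "\<epsilon> > 0"
    using assms by (simp add: \<epsilon>_def)
  have Q: "Q = (\<Sum>i\<in>T. \<epsilon> * real (nat \<lfloor>min (v i) \<theta> / \<epsilon>\<rfloor>))"
    by (simp add: Q_def sum_distrib_left)
  have floor: "\<epsilon> * real (nat \<lfloor>min (v i) \<theta> / \<epsilon>\<rfloor>) = \<epsilon> * \<lfloor>min (v i) \<theta> / \<epsilon>\<rfloor>" if "i \<in> T" for i
    using assms(5,6) that \<epsilon> by (simp add: min_def)
  have up: "\<epsilon> * real (nat \<lfloor>min (v i) \<theta> / \<epsilon>\<rfloor>) \<le> min (v i) \<theta>" if "i \<in> T" for i
  proof -
    have "\<epsilon> * \<lfloor>min (v i) \<theta> / \<epsilon>\<rfloor> \<le> \<epsilon> * (min (v i) \<theta> / \<epsilon>)"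
      using \<epsilon> by (intro mult_left_mono) auto
    then show ?thesis using floor[OF that] \<epsilon> by simp
  qed
  have low: "min (v i) \<theta> \<le> \<epsilon> * real (nat \<lfloor>min (v i) \<theta> / \<epsilon>\<rfloor>) + \<epsilon>" if "i \<in> T" for i
  proof -
    have "\<epsilon> * (min (v i) \<theta> / \<epsilon>) \<le> \<epsilon> * (\<lfloor>min (v i) \<theta> / \<epsilon>\<rfloor> + 1)"
      using \<epsilon> by (intro mult_left_mono) linarith+
    then show ?thesis using floor[OF that] \<epsilon> by (simp add: distrib_left)
  qed
  show ?thesis
  proof (cases "\<theta> \<le> (\<Sum>i\<in>T. v i)")
    case True
    have "\<theta> \<le> (\<Sum>i\<in>T. min (v i) \<theta>)"
    proof (cases "\<exists>i\<in>T. \<theta> \<le> v i")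
      case True
      then obtain i where "i \<in> T" "\<theta> \<le> v i" by blast
      then show ?thesis
        using member_le_sum[of i T "\<lambda>i. min (v i) \<theta>"] assms by auto
    next
      case False
      then have "(\<Sum>i\<in>T. min (v i) \<theta>) = (\<Sum>i\<in>T. v i)"
        by (intro sum.cong) auto
      then show ?thesis using True by simp
    qed
    also have "\<dots> \<le> (\<Sum>i\<in>T. \<epsilon> * real (nat \<lfloor>min (v i) \<theta> / \<epsilon>\<rfloor>) + \<epsilon>)"
      by (intro sum_mono low)
    also have "\<dots> = Q + real (card T) * \<epsilon>"
      by (simp add: Q sum.distrib)
    also have "real (card T) * \<epsilon> \<le> real M * \<epsilon>"
      using assms(2) \<epsilon> by (intro mult_right_mono) auto
    also have "real M * \<epsilon> < m"
      using assms(3,4) by (simp add: \<epsilon>_def)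
    finally show ?thesis using True by (simp add: Q_def)
  next
    case False
    have "Q \<le> (\<Sum>i\<in>T. v i)"
      unfolding Q using up by (intro sum_mono) (meson min.boundedE)
    then show ?thesis using False margin by (simp add: Q_def)
  qed
qed

section \<open>The sketch and its error probability\<close>

text \<open>The numeric hypotheses match the separate needs: those on \<open>M\<close> and
  \<open>q\<close> make the sparse columns detect large sets, those on \<open>b\<close> make
  collisions rare, and the one on \<open>k\<close> lets the code separate sets of at most
  \<open>M\<close> pairs.\<close>

lemma ltf_has_lin_sketch:
  fixes w :: "real vec" and \<theta> :: real and M q b k :: nat
  defines "m \<equiv> ltf_margin w \<theta>"
  defines "\<rho> \<equiv> \<theta> / m"
  assumes w: "w \<in> carrier_vec n" and nonneg: "\<forall>i<n. 0 \<le> w $ i" and \<theta>: "0 < \<theta>" and m: "0 < m"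
    and \<delta>: "0 < \<delta>" "\<delta> < 1"
    and M: "\<rho> \<le> real M" "(1 - \<delta> / \<rho>) ^ M \<le> \<delta> / 2"
    and q: "1 / 2 ^ q \<le> \<delta> / 2"
    and b: "b > 0" "2 * (real M)\<^sup>2 \<le> \<delta> * real b"
    and k: "((nat \<lfloor>2 * real M * \<rho>\<rfloor> + 1) * b + 1) ^ (2 * M) < 2 ^ k"
  shows "has_lin_sketch n \<delta> (ltf w \<theta>) (k + q)"
proof -
  define N where "N = (nat \<lfloor>2 * real M * \<rho>\<rfloor> + 1) * b"
  define \<epsilon> where "\<epsilon> = m / (2 * real M)"
  define p where "p = \<delta> / \<rho>"
  define \<kappa> where "\<kappa> i = nat \<lfloor>min (w $ i) \<theta> / \<epsilon>\<rfloor>" for i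
  define J where "J = {i. i < n \<and> 2 * m \<le> w $ i}"
  have "m \<le> \<theta>"
    using ltf_margin_le[OF w, of "{}" \<theta>] \<theta> by (simp add: m_def)
  then have \<rho>: "1 \<le> \<rho>"
    using m by (simp add: \<rho>_def)
  have M0: "M > 0"
    using M(1) \<rho> by (simp add: flip: of_nat_0_less_iff)
  have \<epsilon>: "\<epsilon> > 0" using m M0 by (simp add: \<epsilon>_def)
  have p: "0 \<le> p" "p \<le> 1"
    using \<delta> \<rho> by (auto simp: p_def field_simps)
  \<comment> \<open>The pair of class \<kappa> and bucket \<open>r\<close> is stored as the single
    number \<open>\<kappa> i * b + r\<close>, so that \<open>div b\<close> returns the class.
    Capping at \<theta> bounds the number of classes.\<close>
  have \<kappa>_less: "\<kappa> i * b + r < N" if "r < b" for i r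
  proof -
    have "min (w $ i) \<theta> / \<epsilon> \<le> \<theta> / \<epsilon>"
      using \<epsilon> by (intro divide_right_mono) auto
    also have "\<theta> / \<epsilon> = 2 * real M * \<rho>"
      using m M0 by (simp add: \<epsilon>_def \<rho>_def)
    finally have "\<kappa> i \<le> nat \<lfloor>2 * real M * \<rho>\<rfloor>"
      unfolding \<kappa>_def by (intro nat_mono floor_mono)
    then have "\<kappa> i * b + b \<le> N"
      unfolding N_def by (metis Suc_eq_plus1 add.commute mult_Suc mult_le_mono1 not_less_eq_eq)
    then show ?thesis using that by simp
  qed
  obtain u :: "nat \<Rightarrow> nat \<Rightarrow> bit" where u: "\<And>S S'. S \<subseteq> {..<N} \<Longrightarrow> S' \<subseteq> {..<N} \<Longrightarrow>
      card S \<le> M \<Longrightarrow> card S' \<le> M \<Longrightarrow> \<forall>j<k. (\<Sum>i\<in>S. u i j) = (\<Sum>i\<in>S'. u i j) \<Longrightarrow> S = S'"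
    using exists_columns_inj_subset_sums[of N M k] k unfolding N_def by metis
  define decode where "decode v = (SOME S. S \<subseteq> {..<N} \<and> card S \<le> M \<and> (\<forall>j<k. (\<Sum>l\<in>S. u l j) = v $ j))" for v :: "bit vec"
  define g :: "bit vec \<Rightarrow> bit" where "g v = of_bool ((\<exists>j<q. v $ (k + j) \<noteq> 0) \<or>
      \<theta> - m < \<epsilon> * real (\<Sum>l\<in>decode v. l div b))" for v
  \<comment> \<open>Light coordinates get the zero column. For heavy ones the randomness enters the
    code part only through the choice of the codeword, so \<open>decode\<close> and \<open>g\<close>
    are fixed functions.\<close>
  define col :: "(nat \<Rightarrow> nat) \<times> (nat \<Rightarrow> nat \<Rightarrow> bit) \<Rightarrow> nat \<Rightarrow> nat \<Rightarrow> bit" where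
    "col \<omega> i j = (if i \<in> J then if j < k then u (\<kappa> i * b + fst \<omega> i) j else snd \<omega> i (j - k) else 0)" for \<omega> i j
  define P1 where "P1 = Pi_pmf {..<n} 0 (\<lambda>_. pmf_of_set {..<b})"
  define P2 where "P2 = Pi_pmf {..<n} (\<lambda>_. 0) (\<lambda>_. sparse_column p q)"
  show ?thesis
  proof (rule has_lin_sketchI[where P = "pair_pmf P1 P2" and col = col and g = g])
    fix x :: "bit vec" assume "x \<in> carrier_vec n"
    define T where "T = {i. i < n \<and> 2 * m \<le> w $ i \<and> x $ i = 1}"
    define y where "y \<omega> = vec (k + q) (\<lambda>j. \<Sum>i | i < n \<and> x $ i = 1. col \<omega> i j)" for \<omega>
    have T: "finite T" "T \<subseteq> {..<n}"
      by (auto simp: T_def)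
    have f: "ltf w \<theta> x = of_bool (\<theta> \<le> (\<Sum>i\<in>T. w $ i))"
      using ltf_eq_heavy[OF w nonneg m[unfolded m_def]] by (simp add: T_def m_def)
    have margin: "m \<le> \<bar>(\<Sum>i\<in>T. w $ i) - \<theta>\<bar>"
      using ltf_margin_le[OF w T(2)] by (simp add: m_def)
    have large: "real (card T) * (2 * m) \<le> (\<Sum>i\<in>T. w $ i)"
      using sum_bounded_below[of T "2 * m" "\<lambda>i. w $ i"] by (simp add: T_def)
    have y_sum: "y \<omega> $ j = (\<Sum>i\<in>T. col \<omega> i j)" if "j < k + q" for \<omega> j
    proof -
      have "(\<Sum>i | i < n \<and> x $ i = 1. col \<omega> i j) = (\<Sum>i\<in>T. col \<omega> i j)"
        by (intro sum.mono_neutral_right) (auto simp: T_def col_def J_def)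
      then show ?thesis using that by (simp add: y_def)
    qed
    have TJ: "T \<subseteq> J" by (auto simp: T_def J_def)
    have y1: "y \<omega> $ j = (\<Sum>i\<in>T. u (\<kappa> i * b + fst \<omega> i) j)" if "j < k" for \<omega> j
      using that TJ by (auto simp: y_sum col_def intro!: sum.cong)
    have y2: "y \<omega> $ (k + j) = (\<Sum>i\<in>T. snd \<omega> i j)" if "j < q" for \<omega> j
      using that TJ by (auto simp: y_sum col_def intro!: sum.cong)
    \<comment> \<open>\<open>E1\<close> counts collisions anywhere in \<open>T\<close>, not only
      within one class; since \<open>b\<close> is quadratic in \<open>M\<close> this cruder event is
      still rare.\<close>
    define E1 where "E1 = {r :: nat \<Rightarrow> nat. \<not> inj_on r T}"
    define E2 where "E2 = {c :: nat \<Rightarrow> nat \<Rightarrow> bit. \<forall>j<q. (\<Sum>i\<in>T. c i j) = 0}"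
    have decode_correct: "g (y \<omega>) = ltf w \<theta> x"
      if \<omega>: "\<omega> \<in> set_pmf (pair_pmf P1 P2)" "fst \<omega> \<notin> E1" "snd \<omega> \<in> E2" "card T \<le> M" for \<omega>
    proof -
      let ?l = "\<lambda>i. \<kappa> i * b + fst \<omega> i"
      have "fst \<omega> \<in> set_pmf P1"
        using \<omega>(1) by auto
      then have "fst \<omega> \<in> PiE_dflt {..<n} 0 (\<lambda>_. set_pmf (pmf_of_set {..<b}))"
        unfolding P1_def by (simp add: set_Pi_pmf o_def)
      moreover have "set_pmf (pmf_of_set {..<b}) = {..<b}"
        using b(1) by (intro set_pmf_of_set) auto
      ultimately have r: "fst \<omega> i < b" if "i \<in> T" for i
        using that T(2) unfolding PiE_dflt_def by auto
      have mod: "?l i mod b = fst \<omega> i" and div: "?l i div b = \<kappa> i" if "i \<in> T" for i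
        using r[OF that] by auto
      have inj: "inj_on ?l T"
      proof (rule inj_onI)
        fix i j assume ij: "i \<in> T" "j \<in> T" and "?l i = ?l j"
        then have "fst \<omega> i = fst \<omega> j"
          using mod by metis
        then show "i = j"
          using \<omega>(2) ij by (simp add: E1_def inj_on_def)
      qed
      have S: "?l ` T \<subseteq> {..<N}" "card (?l ` T) \<le> M" "\<forall>j<k. (\<Sum>l\<in>?l ` T. u l j) = y \<omega> $ j"
      proof -
        show "?l ` T \<subseteq> {..<N}"
          using \<kappa>_less[OF r] by (intro image_subsetI) simp
        show "card (?l ` T) \<le> M"
          unfolding card_image[OF inj] by (rule \<omega>(4))
        show "\<forall>j<k. (\<Sum>l\<in>?l ` T. u l j) = y \<omega> $ j"
          using y1 by (simp add: sum.reindex[OF inj])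
      qed
      define S where "S = decode (y \<omega>)"
      \<comment> \<open>The image of \<open>T\<close> witnesses that the choice in
        \<open>decode\<close> is satisfiable; the code property \<open>u\<close> then forces the
        chosen set to be this image.\<close>
      have "S \<subseteq> {..<N} \<and> card S \<le> M \<and> (\<forall>j<k. (\<Sum>l\<in>S. u l j) = y \<omega> $ j)"
        unfolding S_def decode_def by (rule someI[of _ "?l ` T"]) (use S in blast)
      then have "decode (y \<omega>) = ?l ` T"
        unfolding S_def[symmetric] using S by (intro u) auto
      then have "(\<Sum>l\<in>decode (y \<omega>). l div b) = (\<Sum>i\<in>T. \<kappa> i)"
        using inj div by (simp add: sum.reindex)
      moreover have "\<theta> - m < \<epsilon> * real (\<Sum>i\<in>T. \<kappa> i) \<longleftrightarrow> \<theta> \<le> (\<Sum>i\<in>T. w $ i)"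
        unfolding \<kappa>_def \<epsilon>_def using T \<omega>(4) M0 m \<theta> nonneg margin
        by (intro rounded_threshold) auto
      moreover have "\<not> (\<exists>j<q. y \<omega> $ (k + j) \<noteq> 0)"
        using \<omega>(3) y2 by (auto simp: E2_def)
      ultimately show ?thesis
        unfolding g_def f by simp
    qed
    have reject: "g (y \<omega>) = 1" if "snd \<omega> \<notin> E2" for \<omega>
    proof -
      have "\<exists>j<q. y \<omega> $ (k + j) \<noteq> 0"
        using that y2[of _ \<omega>] by (auto simp: E2_def)
      then show ?thesis by (simp add: g_def)
    qed
    have prob1: "measure_pmf.prob (pair_pmf P1 P2) {\<omega>. fst \<omega> \<in> E1} \<le> \<delta> / 2" if "card T \<le> M"
    proof -
      have "measure_pmf.prob (pair_pmf P1 P2) {\<omega>. fst \<omega> \<in> E1} = measure_pmf.prob (map_pmf fst (pair_pmf P1 P2)) E1"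
        by (simp add: vimage_def)
      also have "\<dots> = measure_pmf.prob (Pi_pmf T 0 (\<lambda>_. pmf_of_set {..<b})) E1"
        unfolding map_fst_pair_pmf P1_def using T
        by (intro prob_Pi_pmf_subset) (auto simp: E1_def inj_on_def)
      also have "\<dots> \<le> (real (card T))\<^sup>2 / real b"
        unfolding E1_def using T b by (intro prob_not_inj_on)
      also have "\<dots> \<le> (real M)\<^sup>2 / real b"
        using that by (intro divide_right_mono power_mono) auto
      also have "\<dots> \<le> \<delta> / 2"
        using b by (simp add: field_simps)
      finally show ?thesis .
    qed
    have prob2: "measure_pmf.prob (pair_pmf P1 P2) {\<omega>. snd \<omega> \<in> E2} = 1 / 2 ^ q + (1 - p) ^ card T * (1 - 1 / 2 ^ q)"
    proof -
      have "measure_pmf.prob (pair_pmf P1 P2) {\<omega>. snd \<omega> \<in> E2} = measure_pmf.prob (map_pmf snd (pair_pmf P1 P2)) E2"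
        by (simp add: vimage_def)
      also have "\<dots> = measure_pmf.prob (Pi_pmf T (\<lambda>_. 0) (\<lambda>_. sparse_column p q)) E2"
        unfolding map_snd_pair_pmf P2_def using T
        by (intro prob_Pi_pmf_subset) (auto simp: E2_def)
      also have "\<dots> = 1 / 2 ^ q + (1 - p) ^ card T * (1 - 1 / 2 ^ q)"
        unfolding E2_def using T p by (intro prob_sum_sparse_columns_eq_0)
      finally show ?thesis .
    qed
    let ?pr = "measure_pmf.prob (pair_pmf P1 P2)"
    have bad: "?pr {\<omega>. g (y \<omega>) \<noteq> ltf w \<theta> x} \<le> \<delta>"
    proof (cases "card T \<le> M")
      case True
      show ?thesis
      proof (cases "\<theta> \<le> (\<Sum>i\<in>T. w $ i)")
        \<comment> \<open>Here answering 1 is correct, so a nonvanishing sparse sum does no harm and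
          only collisions can cause an error.\<close>
        case 1: True
        have "?pr {\<omega>. g (y \<omega>) \<noteq> ltf w \<theta> x} \<le> ?pr {\<omega>. fst \<omega> \<in> E1}"
        proof (intro measure_pmf.finite_measure_mono_AE AE_pmfI impI)
          fix \<omega> assume "\<omega> \<in> set_pmf (pair_pmf P1 P2)" "\<omega> \<in> {\<omega>. g (y \<omega>) \<noteq> ltf w \<theta> x}"
          then show "\<omega> \<in> {\<omega>. fst \<omega> \<in> E1}"
            using decode_correct[of \<omega>] reject[of \<omega>] True f 1 by auto
        qed simp
        then show ?thesis using prob1[OF True] \<delta> by linarith
      next
        case 0: False
        \<comment> \<open>Each element of \<open>T\<close> weighs at least \<open>2 * m\<close>,
          which bounds \<open>card T * p\<close> by \<open>\<delta> / 2\<close>; Bernoulli's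
          inequality then shows that the sparse sum vanishes with probability at least
          \<open>1 - \<delta> / 2\<close>.\<close>
        have "real (card T) * (2 * m) \<le> \<theta>"
          using large 0 by linarith
        then have "real (card T) \<le> \<rho> / 2"
          using m by (simp add: \<rho>_def field_simps)
        then have "real (card T) * p \<le> \<delta> / 2"
          using mult_right_mono[of "real (card T)" "\<rho> / 2" p] p \<rho> by (simp add: p_def)
        moreover have "1 - real (card T) * p \<le> (1 - p) ^ card T"
          using Bernoulli_inequality[of "- p" "card T"] p by simp
        moreover have "(1 - p) ^ card T \<le> 1 / 2 ^ q + (1 - p) ^ card T * (1 - 1 / 2 ^ q)"
          using power_le_one[of "1 - p" "card T"] p by (simp add: field_simps)
        ultimately have "?pr {\<omega>. snd \<omega> \<in> E2} \<ge> 1 - \<delta> / 2"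
          using prob2 by linarith
        then have "?pr {\<omega>. snd \<omega> \<notin> E2} \<le> \<delta> / 2"
          using measure_pmf.prob_compl[of "{\<omega>. snd \<omega> \<in> E2}" "pair_pmf P1 P2"]
          by (simp add: Compl_eq_Diff_UNIV[symmetric] Collect_neg_eq)
        moreover have "?pr {\<omega>. g (y \<omega>) \<noteq> ltf w \<theta> x} \<le> ?pr ({\<omega>. fst \<omega> \<in> E1} \<union> {\<omega>. snd \<omega> \<notin> E2})"
        proof (intro measure_pmf.finite_measure_mono_AE AE_pmfI impI)
          fix \<omega> assume "\<omega> \<in> set_pmf (pair_pmf P1 P2)" "\<omega> \<in> {\<omega>. g (y \<omega>) \<noteq> ltf w \<theta> x}"
          then show "\<omega> \<in> {\<omega>. fst \<omega> \<in> E1} \<union> {\<omega>. snd \<omega> \<notin> E2}"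
            using decode_correct[of \<omega>] True by auto
        qed simp
        moreover have "\<dots> \<le> ?pr {\<omega>. fst \<omega> \<in> E1} + ?pr {\<omega>. snd \<omega> \<notin> E2}"
          by (intro measure_Un_le) auto
        ultimately show ?thesis using prob1[OF True] by linarith
      qed
    next
      case False
      \<comment> \<open>So many heavy coordinates exceed the threshold. The answer must be 1, and an
        error requires the sparse sum to vanish.\<close>
      have "\<theta> = \<rho> * m"
        using m by (simp add: \<rho>_def)
      also have "\<dots> \<le> real (card T) * (2 * m)"
      proof -
        have "\<rho> \<le> real (card T) * 2"
          using M(1) False by simp
        then show ?thesis
          using m mult_right_mono[of \<rho> "real (card T) * 2" m] by simp
      qed
      finally have "\<theta> \<le> (\<Sum>i\<in>T. w $ i)"
        using large by linarith
      then have "{\<omega>. g (y \<omega>) \<noteq> ltf w \<theta> x} \<subseteq> {\<omega>. snd \<omega> \<in> E2}"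
        using reject f by fastforce
      then have "?pr {\<omega>. g (y \<omega>) \<noteq> ltf w \<theta> x} \<le> ?pr {\<omega>. snd \<omega> \<in> E2}"
        by (intro measure_pmf.finite_measure_mono) auto
      also have "\<dots> \<le> 1 / 2 ^ q + (1 - p) ^ card T"
        unfolding prob2 using p by (simp add: field_simps)
      also have "(1 - p) ^ card T \<le> (1 - p) ^ M"
        using False p by (intro power_decreasing) auto
      finally show ?thesis
        using q M(2) by (simp add: p_def)
    qed
    have "?pr {\<omega>. g (y \<omega>) = ltf w \<theta> x} = 1 - ?pr {\<omega>. g (y \<omega>) \<noteq> ltf w \<theta> x}"
      using measure_pmf.prob_compl[of "{\<omega>. g (y \<omega>) \<noteq> ltf w \<theta> x}" "pair_pmf P1 P2"]
      by (simp add: Compl_eq_Diff_UNIV[symmetric] Collect_neg_eq)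
    with bad show "1 - \<delta> \<le> ?pr {\<omega>. g (vec (k + q) (\<lambda>j. \<Sum>i | i < n \<and> x $ i = 1. col \<omega> i j)) = ltf w \<theta> x}"
      by (simp add: y_def)
  qed
qed

section \<open>Choice of parameters and the final bound\<close>

lemma ltf_R_lin_le:
  fixes \<delta> :: real and K q :: nat
  assumes w: "w \<in> carrier_vec n" and nonneg: "\<forall>i<n. 0 \<le> w $ i" and \<theta>: "0 < \<theta>" and m: "0 < ltf_margin w \<theta>"
    and \<delta>: "0 < \<delta>" "\<delta> < 1 / 2"
    and K: "2 / \<delta>\<^sup>2 \<le> real K" and q: "1 / 2 ^ q \<le> \<delta> / 2"
  shows "real (R_lin n \<delta> (ltf w \<theta>)) \<le>
    (4 * real K * (log 2 (16 * real K ^ 4 / \<delta>) + 5) + 1 + real q) *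
      (\<theta> / ltf_margin w \<theta>) * log 2 (2 * \<theta> / ltf_margin w \<theta>)"
proof -
  define \<rho> where "\<rho> = \<theta> / ltf_margin w \<theta>"
  define M where "M = K * nat \<lceil>\<rho>\<rceil>"
  define b where "b = nat \<lceil>2 * (real M)\<^sup>2 / \<delta>\<rceil>"
  define N where "N = (nat \<lfloor>2 * real M * \<rho>\<rfloor> + 1) * b"
  define L where "L = nat \<lceil>log 2 (real (N + 1))\<rceil>"
  \<comment> \<open>\<open>L\<close> bits suffice for \<open>N + 1\<close> values, so
    \<open>(N + 1) ^ (2 * M)\<close> is at most \<open>2 ^ (2 * M * L)\<close>; the extra 1 makes
    the inequality strict.\<close>
  define k where "k = 2 * M * L + 1"
  define A where "A = log 2 (16 * real K ^ 4 / \<delta>)"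
  have "ltf_margin w \<theta> \<le> \<theta>"
    using ltf_margin_le[OF w, of "{}" \<theta>] \<theta> by simp
  then have \<rho>: "1 \<le> \<rho>"
    using m by (simp add: \<rho>_def)
  have \<delta>2: "0 < \<delta>\<^sup>2" "\<delta>\<^sup>2 \<le> 1"
    using \<delta> by (auto simp: power_le_one)
  then have "2 \<le> 2 / \<delta>\<^sup>2"
    by (simp add: field_simps)
  then have K1: "1 \<le> real K"
    using K by linarith
  have ceil: "\<rho> \<le> real (nat \<lceil>\<rho>\<rceil>)" "real (nat \<lceil>\<rho>\<rceil>) \<le> 2 * \<rho>"
    using \<rho> by linarith+
  have MK: "real K * \<rho> \<le> real M" "real M \<le> real K * (2 * \<rho>)"
    unfolding M_def of_nat_mult using ceil by (auto intro: mult_left_mono)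
  have M\<rho>: "\<rho> \<le> real M"
  proof -
    have "1 * \<rho> \<le> real K * \<rho>"
      using K1 \<rho> by (intro mult_right_mono) auto
    then show ?thesis using MK(1) by linarith
  qed
  have M1: "1 \<le> real M"
    using M\<rho> \<rho> by linarith
  \<comment> \<open>The power is at most \<open>exp (- K * \<delta>)\<close>, and the crude bound
    \<open>exp t >= t\<close> turns the choice of \<open>K\<close> into
    \<open>exp (K * \<delta>) >= 2 / \<delta>\<close>.\<close>
  have tail: "(1 - \<delta> / \<rho>) ^ M \<le> \<delta> / 2"
  proof -
    have "0 \<le> 1 - \<delta> / \<rho>"
      using \<delta> \<rho> by (simp add: field_simps)
    moreover have "1 - \<delta> / \<rho> \<le> exp (- (\<delta> / \<rho>))"
      using exp_ge_add_one_self[of "- (\<delta> / \<rho>)"] by simp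
    ultimately have "(1 - \<delta> / \<rho>) ^ M \<le> exp (- (\<delta> / \<rho>)) ^ M"
      by (intro power_mono)
    also have "\<dots> = inverse (exp (real M * (\<delta> / \<rho>)))"
      by (simp flip: exp_of_nat_mult exp_minus)
    also have "\<dots> \<le> inverse (2 / \<delta>)"
    proof (rule le_imp_inverse_le)
      have "2 / \<delta> = 2 / \<delta>\<^sup>2 * \<delta>"
        using \<delta> by (simp add: power2_eq_square)
      also have "\<dots> \<le> real K * \<delta>"
        using K \<delta> by (intro mult_right_mono) auto
      also have "\<dots> = real K * \<rho> * (\<delta> / \<rho>)"
        using \<rho> by simp
      also have "\<dots> \<le> real M * (\<delta> / \<rho>)"
        using MK(1) \<delta> \<rho> by (intro mult_right_mono) auto
      also have "\<dots> \<le> exp (real M * (\<delta> / \<rho>))"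
        using exp_ge_add_one_self[of "real M * (\<delta> / \<rho>)"] by linarith
      finally show "2 / \<delta> \<le> exp (real M * (\<delta> / \<rho>))" .
    qed (use \<delta> in auto)
    finally show ?thesis by simp
  qed
  have b_ge: "2 * (real M)\<^sup>2 / \<delta> \<le> real b"
    unfolding b_def by linarith
  have pos: "0 < 2 * (real M)\<^sup>2 / \<delta>"
    using \<delta> M1 by simp
  have b0: "b > 0"
    using pos b_ge by linarith
  have b2: "2 * (real M)\<^sup>2 \<le> \<delta> * real b"
    using b_ge \<delta> by (simp add: field_simps)
  \<comment> \<open>Both factors of \<open>N\<close> are of order at most \<open>M^2\<close>, up to
    a factor depending on \<delta>, and \<open>M\<close> is linear in \<rho>. Writing the bound in
    powers of \<open>2 * \<rho>\<close> makes its logarithm a constant plus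
    \<open>4 * lg\<close>.\<close>
  have N_le: "real (N + 1) \<le> 16 * real K ^ 4 / \<delta> * (2 * \<rho>) ^ 4"
  proof -
    define X where "X = (real M)\<^sup>2"
    have X1: "1 \<le> X"
      unfolding X_def by (rule one_le_power[OF M1])
    then have X: "1 \<le> X" "1 \<le> X / \<delta>"
      using \<delta> by auto
    have "real (nat \<lfloor>2 * real M * \<rho>\<rfloor> + 1) \<le> 2 * (real M * \<rho>) + 1"
    proof -
      have "0 \<le> 2 * real M * \<rho>"
        using \<rho> by simp
      then show ?thesis by linarith
    qed
    also have "real M * \<rho> \<le> X"
      unfolding X_def power2_eq_square using M\<rho> by (intro mult_left_mono) auto
    finally have 1: "real (nat \<lfloor>2 * real M * \<rho>\<rfloor> + 1) \<le> 3 * X"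
      using X by linarith
    have 2: "real b \<le> 3 * (X / \<delta>)"
      using X pos unfolding b_def X_def by linarith
    have "real (N + 1) \<le> (3 * X) * (3 * (X / \<delta>)) + 1"
      unfolding N_def of_nat_add of_nat_mult using 1 2 X by (intro add_mono mult_mono) auto
    also have "\<dots> \<le> 16 * (X * (X / \<delta>))"
      using mult_mono[OF X] X by simp
    also have "\<dots> = 16 / \<delta> * real M ^ 4"
      by (simp add: X_def power2_eq_square power4_eq_xxxx)
    also have "\<dots> \<le> 16 / \<delta> * (real K * (2 * \<rho>)) ^ 4"
      using MK(2) \<delta> by (intro mult_left_mono power_mono) auto
    also have "\<dots> = 16 * real K ^ 4 / \<delta> * (2 * \<rho>) ^ 4"
      by (simp add: power_mult_distrib)
    finally show ?thesis .
  qed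
  \<comment> \<open>The factor 2 inside the logarithm gives \<open>lg >= 1\<close> even for
    \<open>\<rho> = 1\<close>, so additive constants can be absorbed into multiples of
    \<open>lg\<close> and of \<open>\<rho> * lg\<close>.\<close>
  define lg where "lg = log 2 (2 * \<rho>)"
  have lg: "1 \<le> lg"
    using \<rho> by (simp add: lg_def)
  have A: "0 \<le> A"
  proof -
    have "1 \<le> real K ^ 4" by (rule one_le_power[OF K1])
    then have "1 \<le> 16 * real K ^ 4 / \<delta>"
      using \<delta> by (simp add: field_simps)
    then show ?thesis by (simp add: A_def)
  qed
  have "log 2 (real (N + 1)) \<le> log 2 (16 * real K ^ 4 / \<delta> * (2 * \<rho>) ^ 4)"
    using N_le by (intro log_mono) auto
  also have "\<dots> = A + 4 * lg"
  proof -
    have pos: "0 < 16 * real K ^ 4 / \<delta>" "0 < (2 * \<rho>) ^ 4" "0 \<le> 2 * \<rho>"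
      using \<delta> K1 \<rho> by auto
    show ?thesis
      using log_mult_pos[OF pos(1,2), of 2] log_nat_power[OF pos(3), of 2 4]
      unfolding A_def lg_def by linarith
  qed
  finally have logN: "log 2 (real (N + 1)) \<le> A + 4 * lg" .
  have L: "log 2 (real (N + 1)) \<le> real L" "real L \<le> (A + 5) * lg"
  proof -
    show "log 2 (real (N + 1)) \<le> real L"
      unfolding L_def by linarith
    have "0 \<le> log 2 (real (N + 1))" by simp
    then have "real L \<le> log 2 (real (N + 1)) + 1"
      unfolding L_def by linarith
    moreover have "A \<le> A * lg"
      using mult_left_mono[OF lg A] by simp
    ultimately show "real L \<le> (A + 5) * lg"
      using logN lg by (simp add: distrib_right)
  qed
  have "real (N + 1) \<le> 2 ^ L"
    using L(1) by (subst (asm) log_le_iff) (auto simp: powr_realpow)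
  then have "N + 1 \<le> 2 ^ L"
    by (metis of_nat_le_iff of_nat_numeral of_nat_power)
  then have "(N + 1) ^ (2 * M) \<le> (2 ^ L) ^ (2 * M)"
    by (rule power_mono) simp
  also have "\<dots> < 2 ^ k"
    by (simp add: k_def mult.commute flip: power_mult)
  finally have "(N + 1) ^ (2 * M) < 2 ^ k" .
  then have "has_lin_sketch n \<delta> (ltf w \<theta>) (k + q)"
    using w nonneg \<theta> m \<delta> M\<rho> tail q b0 b2 unfolding N_def \<rho>_def
    by (intro ltf_has_lin_sketch[where M = M and b = b]) auto
  then have "R_lin n \<delta> (ltf w \<theta>) \<le> k + q"
    unfolding R_lin_def by (rule Least_le)
  then have "real (R_lin n \<delta> (ltf w \<theta>)) \<le> real k + real q"
    by linarith
  also have "\<dots> = 2 * real M * real L + (1 + real q)"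
    by (simp add: k_def)
  also have "\<dots> \<le> 2 * (real K * (2 * \<rho>)) * ((A + 5) * lg) + (1 + real q) * (\<rho> * lg)"
  proof (rule add_mono)
    show "2 * real M * real L \<le> 2 * (real K * (2 * \<rho>)) * ((A + 5) * lg)"
      using MK(2) L(2) \<rho> by (intro mult_mono) auto
    have "1 \<le> \<rho> * lg"
      using mult_mono[OF \<rho> lg] \<rho> by simp
    then show "1 + real q \<le> (1 + real q) * (\<rho> * lg)"
      using mult_left_mono[of 1 "\<rho> * lg" "1 + real q"] by simp
  qed
  also have "\<dots> = (4 * real K * (A + 5) + 1 + real q) * \<rho> * lg"
    by (simp add: algebra_simps)
  finally show ?thesis
    by (simp add: A_def \<rho>_def lg_def)
qed

theorem theorem6p6:
  fixes \<delta> :: real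
  assumes "0 < \<delta>" and "\<delta> < 1 / 2"
  shows "\<exists>C::real. \<forall>(n::nat) (w::real vec) (\<theta>::real).
           w \<in> carrier_vec n \<longrightarrow>
           (\<forall>i j. i \<le> j \<longrightarrow> j < n \<longrightarrow> w $ j \<le> w $ i) \<longrightarrow>
           (\<forall>i<n. 0 \<le> w $ i) \<longrightarrow>
           (\<Sum>i<n. w $ i) = 1 \<longrightarrow>
           0 < \<theta> \<longrightarrow>
           0 < ltf_margin w \<theta> \<longrightarrow>
           real (R_lin n \<delta> (ltf w \<theta>))
             \<le> C * (\<theta> / ltf_margin w \<theta>) * log 2 (2 * \<theta> / ltf_margin w \<theta>)"
proof -
  obtain K :: nat where K: "2 / \<delta>\<^sup>2 \<le> real K"
    using real_arch_simple by blast
  obtain q :: nat where "(1 / 2) ^ q < \<delta> / 2"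
    using real_arch_pow_inv[of "\<delta> / 2" "1 / 2"] assms by auto
  then have q: "1 / 2 ^ q \<le> \<delta> / 2"
    by (simp add: power_one_over)
  show ?thesis
    using ltf_R_lin_le[OF _ _ _ _ assms K q] by blast
qed

end
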